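(* Let $(X,d)$ be a separable metric space which is directionally $(\xi,\eta,\zeta)$-limited at $X$. Let $\mu$ be a positive Borel measure on $X$, finite on bounded sets. Let $\mathcal C$ be the family of closed balls in $X$ and let $p$ be the premeasure defined on $\mathcal C$ by $p(B)=\mu(B)$. Denote by $\mu^{p,\ast}$ the metric outer measure obtained by Carathéodory's metric construction (Method II) applied to $(\mathcal C,p)$ and by $\mu^p$ the Borel measure associated with $\mu^{p,\ast}$ (its restriction to Borel sets). Then $\mu^p=\mu$.
   Context: Balls: $B_r(x)=\{y\in X: d(x,y)\le r\}$ is the closed ball and $U_r(x)=\{y\in X: d(x,y)<r\}$ the open ball, $r>0$. Directionally limited: let $\xi>0$, $0<\eta\le\frac13$, $\zeta\in\{1,2,\dots\}$ and $A\subset X$. The distance $d$ is directionally $(\xi,\eta,\zeta)$-limited at $A$ if, for every $a\in A$ and every $B\subset A\cap(U_\xi(a)\setminus\{a\})$ with the property that for all $b,c\in B$ with $b\ne c$ and $d(a,b)\ge d(a,c)$ and all $x\in X$ with $d(a,x)=d(a,c)$ and $d(a,x)+d(x,b)=d(a,b)$ one has $\frac{d(x,c)}{d(a,c)}\ge\eta$, it holds that $\operatorname{card}B\le\zeta$. Carathéodory's Method II: the family $\mathcal C$ is understood to contain $\emptyset$, with $p(\emptyset)=0$. For $\delta>0$ let $\mathcal C_\delta=\{B\in\mathcal C:\operatorname{diam}B\le\delta\}$, and for $E\subset X$ let $\mu^p_\delta(E)=\inf\{\sum_{i=0}^\infty p(A_i): E\subset\bigcup_{i}A_i,\ A_i\in\mathcal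 C_\delta\ \forall i\}$ (with $\inf\emptyset=+\infty$) and $\mu^{p,\ast}(E)=\lim_{\delta\to0}\mu^p_\delta(E)$. This is a metric outer measure, so Borel sets are measurable for it. *)

theory Defs
  imports "HOL-Analysis.Analysis"
begin

text \<open>The quotient never has a vanishing denominator, as \<open>a \<notin> B\<close>. Finiteness of \<open>B\<close> is stated separately because
  \<^const>\<open>card\<close> is 0 on infinite sets.\<close>

definition directionally_limited ::
    "real \<Rightarrow> real \<Rightarrow> nat \<Rightarrow> 'a::metric_space set \<Rightarrow> bool" where
  "directionally_limited \<xi> \<eta> \<zeta> A \<longleftrightarrow>
     (\<forall>a\<in>A. \<forall>B. B \<subseteq> A \<inter> (ball a \<xi> - {a}) \<longrightarrow>
        (\<forall>b\<in>B. \<forall>c\<in>B. b \<noteq> c \<longrightarrow> dist a b \<ge> dist a c \<longrightarrow>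
           (\<forall>x. dist a x = dist a c \<longrightarrow> dist a x + dist x b = dist a b \<longrightarrow>
                dist x c / dist a c \<ge> \<eta>)) \<longrightarrow>
        finite B \<and> card B \<le> \<zeta>)"

text \<open>Method II needs a covering family that contains the empty set.\<close>

definition closed_balls :: "'a::metric_space set set" where
  "closed_balls = insert {} {cball x r | x r. r > 0}"

text \<open>Caratheodory's Method II. The real-valued \<^const>\<open>diameter\<close> is meaningful on bounded sets
  only, hence the explicit boundedness condition. An infimum over no admissible covering
  is \<open>\<infinity>\<close>.\<close>

definition fine_sets :: "'a::metric_space set set \<Rightarrow> real \<Rightarrow> 'a set set" where
  "fine_sets \<C> \<delta> = {B \<in> \<C>. bounded B \<and> diameter B \<le> \<delta>}"

definition method_II_pre ::
    "'a::metric_space set set \<Rightarrow> ('a set \<Rightarrow> ennreal) \<Rightarrow> real \<Rightarrow> 'a set \<Rightarrow> ennreal" where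
  "method_II_pre \<C> p \<delta> E =
     (INF A \<in> {A :: nat \<Rightarrow> 'a set. range A \<subseteq> fine_sets \<C> \<delta> \<and> E \<subseteq> (\<Union>i. A i)}. \<Sum>i. p (A i))"

definition method_II ::
    "'a::metric_space set set \<Rightarrow> ('a set \<Rightarrow> ennreal) \<Rightarrow> 'a set \<Rightarrow> ennreal" where
  "method_II \<C> p E = Lim (at_right 0) (\<lambda>\<delta>. method_II_pre \<C> p \<delta> E)"

text \<open>If \<open>{} \<in> \<C>\<close> and \<open>p {} = 0\<close>, then \<^term>\<open>method_II \<C> p\<close> is a metric outer measure and hence
  countably additive on the Borel sets, so that \<^const>\<open>measure_of\<close> yields its restriction to them
  as a measure.\<close>

definition method_II_measure ::
    "'a::metric_space set set \<Rightarrow> ('a set \<Rightarrow> ennreal) \<Rightarrow> 'a measure" where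
  "method_II_measure \<C> p = measure_of UNIV (sets borel) (method_II \<C> p)"

end

theory Submission
  imports Defs
begin

text \<open>The inequality \<open>\<mu> \<le> \<mu>\<^sup>p\<close> is countable subadditivity. For the converse, a Besicovitch-type covering
  argument (Federer 2.8) is used. Let every point of a set be the centre of a small ball. Selecting centres
  greedily in order of essentially decreasing radius, one gets a covering subfamily in which no ball
  essentially contains the centre of another one. Directional limitation then bounds by \<open>2\<zeta>\<close> the number of
  larger balls of the subfamily that a given one meets, so that finite parts can be coloured by \<open>2\<zeta> + 1\<close>
  colours with balls of equal colour disjoint. Iterating this, finitely many disjoint balls inside
  an open \<open>U \<supseteq> E\<close> with \<open>\<mu> U \<approx> \<mu> E\<close> exhaust \<open>E\<close> up to small measure, and what remains is covered by
  balls inside an open \<open>V\<close> of small measure, whose total measure is at most \<open>(2\<zeta> + 1) \<mu> V\<close>.\<close>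

section \<open>Outer regularity of measures finite on bounded sets\<close>

text \<open>The open neighbourhoods of \<open>F\<close> of radius \<open>1 / (n + 1)\<close>
  decrease to \<open>F\<close>, so continuity from above in a finite measure makes the excess
  arbitrarily small.\<close>

lemma closed_approx_by_open:
  fixes F :: "'a::metric_space set"
  assumes fin: "finite_measure M" and M: "sets M = sets (borel :: 'a measure)" and F: "closed F" and e: "0 < (e::real)"
  shows "\<exists>U. open U \<and> F \<subseteq> U \<and> measure M (U - F) < e"
\<comment> \<open>By convention \<open>infdist x {} = 0\<close>, so the neighbourhoods used below
  would be the whole space for empty \<open>F\<close>.\<close>
proof (cases "F = {}")
  case True
  then show ?thesis using e by (intro exI[of _ "{}"]) simp
next
  case False
  interpret finite_measure M by (rule fin)
  define V where "V n = {x. infdist x F < 1 / real (Suc n)}" for n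
  have opn: "open (V n)" for n
    unfolding V_def by (intro open_Collect_less continuous_intros)
  have sub: "F \<subseteq> V n" for n
    using F by (auto simp: V_def)
  have "(\<Inter>n. V n) \<subseteq> F"
  proof
    fix x assume x: "x \<in> (\<Inter>n. V n)"
    have "infdist x F \<le> 0"
    proof (rule field_le_epsilon)
      fix d :: real assume "0 < d"
      then obtain n where "1 / real (Suc n) < d" using nat_approx_posE by blast
      moreover have "infdist x F < 1 / real (Suc n)" using x unfolding V_def by blast
      ultimately show "infdist x F \<le> 0 + d" by linarith
    qed
    then have "infdist x F = 0" using infdist_nonneg[of x F] by linarith
    then show "x \<in> F" using in_closed_iff_infdist_zero[OF F False] by blast
  qed
  then have empty: "(\<Inter>n. V n - F) = {}" by blast
  have dec: "decseq (\<lambda>n. V n - F)"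
  proof (rule decseq_SucI)
    fix n
    have "1 / real (Suc (Suc n)) \<le> 1 / real (Suc n)" by (simp add: frac_le)
    then show "V (Suc n) - F \<subseteq> V n - F" by (auto simp: V_def)
  qed
  have "range (\<lambda>n. V n - F) \<subseteq> sets M"
    using opn F by (auto simp: M)
  from finite_Lim_measure_decseq[OF this dec]
  have "(\<lambda>n. measure M (V n - F)) \<longlonglongrightarrow> 0" by (simp only: empty measure_empty)
  then have "\<forall>\<^sub>F n in sequentially. measure M (V n - F) < e"
    using e by (rule order_tendstoD)
  then obtain n where "measure M (V n - F) < e"
    by (auto simp: eventually_sequentially)
  with opn sub show ?thesis by blast
qed

text \<open>Approximation from both sides at once makes the property stable under complements, which
  swap the roles of \<open>C\<close> and \<open>U\<close>. Hence an induction over the sigma-algebra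
  generated by the closed sets works.\<close>

lemma borel_approx_by_closed_open:
  fixes A :: "'a::metric_space set"
  assumes fin: "finite_measure M" and M: "sets M = sets (borel :: 'a measure)" and A: "A \<in> sets borel" and e: "0 < (e::real)"
  shows "\<exists>C U. closed C \<and> open U \<and> C \<subseteq> A \<and> A \<subseteq> U \<and> measure M (U - C) < e"
proof -
  interpret finite_measure M by (rule fin)
  have "A \<in> sigma_sets UNIV (Collect closed)"
    using A by (simp add: borel_eq_closed)
  then show ?thesis using e
  proof (induction arbitrary: e rule: sigma_sets.induct)
    case (Basic F)
    then show ?case using closed_approx_by_open[OF fin M, of F e] by auto
  next
    case Empty
    then show ?case by (intro exI[of _ "{}"]) simp
  next
    case (Compl B)
    then obtain C U where "closed C" "open U" "C \<subseteq> B" "B \<subseteq> U" "measure M (U - C) < e"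
      using Compl.IH[OF Compl.prems] by (elim exE conjE)
    moreover have eq: "(UNIV - C) - (UNIV - U) = U - C" by blast
    ultimately have "closed (UNIV - U) \<and> open (UNIV - C) \<and> UNIV - U \<subseteq> UNIV - B \<and> UNIV - B \<subseteq> UNIV - C
        \<and> measure M ((UNIV - C) - (UNIV - U)) < e"
      using eq by (auto intro: closed_Diff open_Diff)
    then show ?case by blast
  next
    case (Union B)
    have "\<exists>C U. closed C \<and> open U \<and> C \<subseteq> B n \<and> B n \<subseteq> U \<and> measure M (U - C) < e/2 * (1/2)^Suc n" for n
      using Union.IH[of "e/2 * (1/2)^Suc n" n] Union.prems by simp
    then obtain C U where CU: "\<And>n. closed (C n)" "\<And>n. open (U n)" "\<And>n. C n \<subseteq> B n"
      "\<And>n. B n \<subseteq> U n" "\<And>n. measure M (U n - C n) < e/2 * (1/2)^Suc n"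
      by metis
    have meas: "C n \<in> sets M" "U n \<in> sets M" for n
      using CU by (auto simp: M)
    define W where "W = (\<Union>n. U n)"
    \<comment> \<open>The union of all \<open>C n\<close> need not be closed. Finite unions are, and
      continuity from above shows that a late one loses little enough.\<close>
    define K where "K m = (\<Union>n<m. C n)" for m
    have W: "W \<in> sets M" and K: "K m \<in> sets M" for m
      using meas by (auto simp: W_def K_def)
    have geo: "(\<lambda>n. e/2 * (1/2)^Suc n) sums (e/2)"
      using sums_mult[OF power_half_series, of "e/2"] by simp
    have "measure M (W - (\<Union>n. C n)) \<le> measure M (\<Union>n. U n - C n)"
      using meas by (intro finite_measure_mono) (auto simp: W_def)
    also have "\<dots> \<le> (\<Sum>n. measure M (U n - C n))"
    proof (rule finite_measure_subadditive_countably)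
      show "range (\<lambda>n. U n - C n) \<subseteq> sets M" using meas by auto
      show "summable (\<lambda>n. measure M (U n - C n))"
        by (rule summable_comparison_test'[OF sums_summable[OF geo], of 0])
          (use CU(5) in \<open>auto intro: less_imp_le\<close>)
    qed
    also have "\<dots> \<le> (\<Sum>n. e/2 * (1/2)^Suc n)"
    proof (rule suminf_le)
      show "summable (\<lambda>n. measure M (U n - C n))"
        by (rule summable_comparison_test'[OF sums_summable[OF geo], of 0])
          (use CU(5) in \<open>auto intro: less_imp_le\<close>)
    qed (use CU(5) geo in \<open>auto intro: less_imp_le sums_summable\<close>)
    also have "\<dots> = e/2" using geo by (rule sums_unique[symmetric])
    finally have small: "measure M (W - (\<Union>n. C n)) < e" using Union.prems by linarith
    have "(\<lambda>m. measure M (W - K m)) \<longlonglongrightarrow> measure M (\<Inter>m. W - K m)"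
    proof (rule finite_Lim_measure_decseq)
      show "decseq (\<lambda>m. W - K m)"
        by (rule decseq_SucI) (auto simp: K_def)
    qed (use W K in auto)
    moreover have "(\<Inter>m. W - K m) = W - (\<Union>n. C n)"
      by (auto simp: K_def)
    ultimately have "\<forall>\<^sub>F m in sequentially. measure M (W - K m) < e"
      using small by (auto intro: order_tendstoD)
    then obtain m where "measure M (W - K m) < e"
      by (auto simp: eventually_sequentially)
    moreover have "closed (K m)" "open W"
      using CU by (auto simp: K_def W_def)
    moreover have "K m \<subseteq> (\<Union>n. B n)" "(\<Union>n. B n) \<subseteq> W"
      using CU(3,4) by (fastforce simp: K_def W_def)+
    ultimately show ?case by blast
  qed
qed

text \<open>The finite case is applied to the restrictions of \<open>\<mu>\<close> to the balls
  \<open>b n\<close>, with errors summing to \<open>e\<close>. The excess \<open>U - A\<close> is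
  estimated directly, so that \<open>A\<close> may have infinite measure.\<close>

lemma outer_regular_of_finite_on_bounded:
  fixes \<mu> :: "'a::metric_space measure"
  assumes M: "sets \<mu> = sets borel"
    and fin: "\<And>B. B \<in> sets borel \<Longrightarrow> bounded B \<Longrightarrow> emeasure \<mu> B < \<infinity>"
    and A: "A \<in> sets borel" and e: "0 < (e::real)"
  obtains U where "open U" "A \<subseteq> U" "emeasure \<mu> (U - A) \<le> ennreal e"
proof -
  fix x0 :: 'a
  define b where "b n = ball x0 (real n)" for n :: nat
  have b: "b n \<in> sets borel" for n by (simp add: b_def)
  have "\<exists>U. open U \<and> A \<subseteq> U \<and> emeasure \<mu> (b n \<inter> (U - A)) \<le> ennreal (e * (1/2)^Suc n)" for n
  proof -
    let ?\<nu> = "density \<mu> (indicator (b n))"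
    have \<nu>: "emeasure ?\<nu> X = emeasure \<mu> (b n \<inter> X)" if "X \<in> sets borel" for X
      using that b by (intro emeasure_restricted) (simp_all add: M)
    have sp: "space \<mu> = UNIV" using sets_eq_imp_space_eq[OF M] by simp
    have fm: "finite_measure ?\<nu>"
      by standard (use fin[of "b n"] b \<nu>[of UNIV] in \<open>auto simp: sp b_def\<close>)
    then interpret finite_measure ?\<nu> .
    have "0 < e * (1/2)^Suc n" using e by simp
    from borel_approx_by_closed_open[OF fm _ A this]
    obtain C U where CU: "closed C" "open U" "C \<subseteq> A" "A \<subseteq> U"
      "measure ?\<nu> (U - C) < e * (1/2)^Suc n" by (auto simp: M)
    have "emeasure \<mu> (b n \<inter> (U - A)) = emeasure ?\<nu> (U - A)"
      using A CU by (intro \<nu>[symmetric]) auto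
    also have "\<dots> \<le> emeasure ?\<nu> (U - C)"
      using A CU by (intro emeasure_mono) (auto simp: M)
    also have "\<dots> \<le> ennreal (e * (1/2)^Suc n)"
      using CU(5) by (simp add: emeasure_eq_measure ennreal_leI)
    finally show ?thesis using CU by blast
  qed
  then obtain U where U: "\<And>n. open (U n)" "\<And>n. A \<subseteq> U n"
    "\<And>n. emeasure \<mu> (b n \<inter> (U n - A)) \<le> ennreal (e * (1/2)^Suc n)" by metis
  \<comment> \<open>Each \<open>U n\<close> is controlled only inside \<open>b n\<close>, hence the
    intersection. As the balls exhaust the space, \<open>A\<close> remains covered.\<close>
  define V where "V = (\<Union>n. b n \<inter> U n)"
  show thesis
  proof
    show "open V" using U by (auto simp: V_def b_def)
    show "A \<subseteq> V"
    proof
      fix x assume "x \<in> A"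
      moreover obtain n where "dist x0 x < real n" using reals_Archimedean2 by blast
      ultimately show "x \<in> V" using U(2) by (auto simp: V_def b_def)
    qed
    have "V - A = (\<Union>n. b n \<inter> (U n - A))" by (auto simp: V_def)
    then have "emeasure \<mu> (V - A) \<le> (\<Sum>n. emeasure \<mu> (b n \<inter> (U n - A)))"
      using U(1) b A by (auto intro!: emeasure_subadditive_countably simp: M)
    also have "\<dots> \<le> (\<Sum>n. ennreal (e * (1/2)^Suc n))"
      using U(3) by (intro suminf_le) auto
    also have "\<dots> = ennreal e"
      using e sums_mult[OF power_half_series, of e]
      by (intro suminf_ennreal_eq) auto
    finally show "emeasure \<mu> (V - A) \<le> ennreal e" .
  qed
qed

section \<open>Greedy selection of a controlled covering family\<close>

text \<open>Membership of \<open>x\<close> depends only on the membership of its predecessors, so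
  well-founded recursion decides it. This is the transfinite greedy choice.\<close>

lemma wf_greedy_selection:
  assumes "wf R"
  shows "\<exists>K. \<forall>x. x \<in> K \<longleftrightarrow> (\<forall>y. (y, x) \<in> R \<longrightarrow> y \<in> K \<longrightarrow> Q x y)"
proof -
  define F where "F = (\<lambda>(f :: 'a \<Rightarrow> bool) x. \<forall>y. (y, x) \<in> R \<longrightarrow> f y \<longrightarrow> Q x y)"
  have *: "wfrec R F x \<longleftrightarrow> (\<forall>y. (y, x) \<in> R \<longrightarrow> wfrec R F y \<longrightarrow> Q x y)" for x
    by (subst wfrec[OF assms]) (simp add: F_def cut_apply)
  show ?thesis
    by (rule exI[of _ "{x. wfrec R F x}"], unfold mem_Collect_eq, rule allI, rule *)
qed

text \<open>The ball with the essentially larger radius (up to the factor \<open>\<tau>\<close>) does not contain the other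
  centre.\<close>

definition controlled :: "real \<Rightarrow> ('a::metric_space \<Rightarrow> real) \<Rightarrow> 'a set \<Rightarrow> bool" where
  "controlled \<tau> r K \<longleftrightarrow> (\<forall>a\<in>K. \<forall>b\<in>K. a \<noteq> b \<longrightarrow>
     (r a < dist a b \<and> r b < \<tau> * r a) \<or> (r b < dist a b \<and> r a < \<tau> * r b))"

text \<open>Infinitely many radii need not have a largest one, so they are sorted only into
  geometric strata, with a well-order breaking ties. An earlier centre then has the larger radius up
  to the factor \<open>\<tau>\<close>, and a rejected centre lies in the ball of an earlier selected
  one.\<close>

lemma controlled_cover:
  fixes r :: "'a::metric_space \<Rightarrow> real"
  assumes \<tau>: "1 < \<tau>" and r: "\<And>x. x \<in> E \<Longrightarrow> 0 < r x \<and> r x \<le> R"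
  obtains K where "K \<subseteq> E" "controlled \<tau> r K" "E \<subseteq> (\<Union>x\<in>K. cball x (r x))"
proof -
  obtain W :: "'a rel" where W: "Well_order W" "Field W = UNIV"
    using well_ordering[where 'a='a] by (elim exE conjE)
  \<comment> \<open>Centres are compared first by the stratum \<open>R \<tau>\<^bsup>-n-1\<^esup> < r x \<le> R \<tau>\<^bsup>-n\<^esup>\<close> of their radius.\<close>
  define n where "n x = nat \<lfloor>log \<tau> (R / r x)\<rfloor>" for x
  define L where "L = inv_image (less_than <*lex*> (W - Id)) (\<lambda>x. (n x, x))"
  have "wf (W - Id)" using W by (simp add: well_order_on_def)
  then have "wf L"
    unfolding L_def by (intro wf_inv_image wf_lex_prod wf_less_than)
  have L_total: "(x, y) \<in> L \<or> (y, x) \<in> L" if "x \<noteq> y" for x y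
    using that W unfolding L_def well_order_on_def linear_order_on_def total_on_def
    by (auto simp: in_inv_image)
  have ratio: "r x < \<tau> * r y" if "(y, x) \<in> L" "x \<in> E" "y \<in> E" for x y
  proof -
    have pos: "0 < r x" "0 < r y" "r x \<le> R" "r y \<le> R" "0 < R" using r that by fastforce+
    have "n y \<le> n x" using that(1) by (auto simp: L_def)
    \<comment> \<open>The logarithms are nonnegative because radii are at most \<open>R\<close>, so
      \<open>nat\<close> truncates nothing in \<open>n\<close>.\<close>
    then have "\<lfloor>log \<tau> (R / r y)\<rfloor> \<le> \<lfloor>log \<tau> (R / r x)\<rfloor>"
      using \<tau> pos by (simp add: n_def le_nat_iff zero_le_log_cancel_iff)
    then have "log \<tau> (R / r y) < log \<tau> (R / r x) + 1" by linarith
    also have "\<dots> = log \<tau> (R / r x * \<tau>)"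
      using \<tau> pos by (subst log_mult) auto
    finally have "R / r y < R / r x * \<tau>"
      using \<tau> pos by simp
    then show ?thesis using pos by (simp add: field_simps)
  qed
  \<comment> \<open>Points outside \<open>E\<close> belong to \<open>K'\<close> vacuously. The guard
    on \<open>y\<close> keeps them from rejecting points of \<open>E\<close>, and intersecting with
    \<open>E\<close> removes them afterwards.\<close>
  obtain K' where K': "\<And>x. x \<in> K' \<longleftrightarrow>
      (\<forall>y. (y, x) \<in> L \<longrightarrow> y \<in> K' \<longrightarrow> x \<in> E \<longrightarrow> y \<in> E \<longrightarrow> r y < dist x y)"
    using wf_greedy_selection[OF \<open>wf L\<close>, of "\<lambda>x y. x \<in> E \<longrightarrow> y \<in> E \<longrightarrow> r y < dist x y"] by blast
  define K where "K = K' \<inter> E"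
  show thesis
  proof
    show "K \<subseteq> E" by (simp add: K_def)
    show "controlled \<tau> r K"
      unfolding controlled_def
    proof (intro ballI impI)
      fix a b assume ab: "a \<in> K" "b \<in> K" "a \<noteq> b"
      from L_total[OF ab(3)] show "r a < dist a b \<and> r b < \<tau> * r a \<or> r b < dist a b \<and> r a < \<tau> * r b"
      proof
        assume "(a, b) \<in> L"
        then show ?thesis using ab ratio[of a b] K'[of b] by (auto simp: K_def dist_commute)
      next
        assume "(b, a) \<in> L"
        then show ?thesis using ab ratio[of b a] K'[of a] by (auto simp: K_def)
      qed
    qed
    show "E \<subseteq> (\<Union>x\<in>K. cball x (r x))"
    proof
      fix x assume x: "x \<in> E"
      show "x \<in> (\<Union>x\<in>K. cball x (r x))"
      proof (cases "x \<in> K")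
        case True
        then show ?thesis using r[OF x] by force
      next
        case False
        then obtain y where "y \<in> K" "\<not> r y < dist x y"
          using x K'[of x] by (auto simp: K_def)
        then show ?thesis by (auto simp: dist_commute not_less)
      qed
    qed
  qed
qed

section \<open>Controlled families: countability, neighbours and colouring\<close>

text \<open>Choosing for each point of \<open>K\<close> a point of a countable dense set within
  \<open>e/2\<close> is injective.\<close>

lemma countable_if_separated:
  fixes K :: "'a::metric_space set"
  assumes sep: "separable_space (euclidean :: 'a topology)" and e: "0 < e"
    and K: "\<And>x y. x \<in> K \<Longrightarrow> y \<in> K \<Longrightarrow> x \<noteq> y \<Longrightarrow> e \<le> dist x y"
  shows "countable K"
proof -
  obtain D :: "'a set" where D: "countable D" "closure D = UNIV"
    using sep by (auto simp: separable_space_def)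
  have "\<exists>y\<in>D. dist y x < e/2" for x
    using D(2) e closure_approachable[of x D] half_gt_zero[OF e] by blast
  then obtain f where f: "\<And>x. f x \<in> D" "\<And>x. dist (f x) x < e/2" by metis
  have "inj_on f K"
  proof (rule inj_onI, rule ccontr)
    fix x y assume xy: "x \<in> K" "y \<in> K" "f x = f y" "x \<noteq> y"
    have "dist x y \<le> dist (f x) x + dist (f y) y"
      using dist_triangle3[of x y "f x"] xy(3) by (simp add: dist_commute)
    with f(2)[of x] f(2)[of y] K[OF xy(1,2,4)] show False by linarith
  qed
  moreover have "countable (f ` K)"
    using f(1) by (intro countable_subset[OF _ D(1)]) auto
  ultimately show ?thesis by (simp add: countable_image_inj_eq)
qed

text \<open>Centres whose radii exceed a fixed bound are separated by that bound, since one of the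
  two radii is smaller than the distance.\<close>

lemma controlled_countable:
  fixes K :: "'a::metric_space set"
  assumes sep: "separable_space (euclidean :: 'a topology)"
    and K: "controlled \<tau> r K" and r: "\<And>x. x \<in> K \<Longrightarrow> 0 < r x"
  shows "countable K"
proof -
  have "countable {x\<in>K. 1 / real (Suc n) < r x}" for n
    by (rule countable_if_separated[OF sep, of "1 / real (Suc n)"])
      (use K in \<open>fastforce simp: controlled_def\<close>)+
  then have "countable (\<Union>n. {x\<in>K. 1 / real (Suc n) < r x})" by (intro countable_UN) auto
  moreover have "K = (\<Union>n. {x\<in>K. 1 / real (Suc n) < r x})"
    using r nat_approx_posE by (auto; metis of_nat_Suc)
  ultimately show ?thesis by simp
qed

text \<open>In either alternative one radius is below the distance and the other is below
  \<open>\<tau>\<close> times that radius, so both bounds hold without knowing which ball was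
  selected first.\<close>

lemma controlled_dist_lower:
  assumes "controlled \<tau> r K" "1 \<le> \<tau>" "a \<in> K" "b \<in> K" "a \<noteq> b" "0 < r a" "0 < r b"
  shows "r a < \<tau> * dist a b" "r b < \<tau> * dist a b"
proof -
  have "dist a b \<le> \<tau> * dist a b" using assms by (simp add: mult_le_cancel_right1)
  moreover have "x < dist a b \<Longrightarrow> \<tau> * x \<le> \<tau> * dist a b" for x
    using assms by (intro mult_left_mono) auto
  ultimately show "r a < \<tau> * dist a b" "r b < \<tau> * dist a b"
    using assms unfolding controlled_def by (smt (verit))+
qed

text \<open>The directional estimate \<open>d(x,c) \<ge> d(b,c) - (d(a,b) - d(a,c)) \<ge> d(a,c)/3\<close> is obtained separately for
  the centres at distance less than \<open>\<beta> r(a)\<close> from \<open>a\<close> and for the others. For \<open>\<tau>\<close> near 1 this needs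
  \<open>\<beta> < 5/3\<close> in the former case and \<open>\<beta> > 3/2\<close> in the latter, whence the choice
  \<open>\<beta> = 8/5\<close>, \<open>\<tau> = 51/50\<close>.\<close>

lemma few_larger_neighbours:
  fixes r :: "'a::metric_space \<Rightarrow> real"
  assumes limited: "directionally_limited \<xi> \<eta> \<zeta> (UNIV :: 'a set)"
    and \<eta>: "0 < \<eta>" "\<eta> \<le> 1/3"
    and K: "controlled (51/50) r K"
    and r: "\<And>x. x \<in> K \<Longrightarrow> 0 < r x \<and> r x < \<xi> / 2"
    and a: "a \<in> K"
    and T: "\<And>b. b \<in> T \<Longrightarrow> b \<in> K \<and> b \<noteq> a \<and> r a \<le> r b \<and> cball a (r a) \<inter> cball b (r b) \<noteq> {}"
  shows "finite T \<and> card T \<le> 2 * \<zeta>"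
proof -
  have upper: "dist a b \<le> r a + r b" if b: "b \<in> T" for b
  proof -
    obtain z where "dist a z \<le> r a" "dist b z \<le> r b" using T[OF b] by auto
    then show ?thesis using dist_triangle2[of a b z] by linarith
  qed
  have lower: "r a < 51/50 * dist a b" "r b < 51/50 * dist a b" if "b \<in> T" for b
    using controlled_dist_lower[OF K _ a, of b] T[OF that] r[of b] r[OF a] by auto
  \<comment> \<open>Radii below \<open>\<xi> / 2\<close> keep the centres of meeting balls within
    distance \<open>\<xi>\<close>, where directional limitation applies.\<close>
  have sub: "B \<subseteq> UNIV \<inter> (ball a \<xi> - {a})" if "B \<subseteq> T" for B
  proof
    fix b assume "b \<in> B"
    then have b: "b \<in> T" using that by blast
    then show "b \<in> UNIV \<inter> (ball a \<xi> - {a})"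
      using T[OF b] upper[OF b] r[of b] r[OF a] by auto
  qed
  have key: "finite B \<and> card B \<le> \<zeta>"
    if B: "B \<subseteq> T" and est: "\<And>b c. b \<in> B \<Longrightarrow> c \<in> B \<Longrightarrow> b \<noteq> c \<Longrightarrow> dist a c \<le> dist a b \<Longrightarrow>
      dist a c / 3 \<le> dist b c - (dist a b - dist a c)" for B
  proof -
    have "\<eta> \<le> dist x c / dist a c"
      if bc: "b \<in> B" "c \<in> B" "b \<noteq> c" "dist a c \<le> dist a b"
        and x: "dist a x = dist a c" "dist a x + dist x b = dist a b" for b c x
    proof -
      have "0 < dist a c" using T[of c] B bc by auto
      have "\<eta> * dist a c \<le> 1/3 * dist a c"
        using \<eta> by (intro mult_right_mono) auto
      also have "\<dots> \<le> dist b c - dist x b" using est[OF bc] x by simp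
      also have "\<dots> \<le> dist x c" using dist_triangle3[of b c x] by simp
      finally show ?thesis using \<open>0 < dist a c\<close> by (simp add: field_simps)
    qed
    then show ?thesis
      using limited[unfolded directionally_limited_def, rule_format, of a B] sub[OF B] by blast
  qed
  define near where "near = {b\<in>T. dist a b < 8/5 * r a}"
  define far where "far = {b\<in>T. 8/5 * r a \<le> dist a b}"
  have pair: "(r b < dist b c \<and> r c < 51/50 * r b) \<or> (r c < dist b c \<and> r b < 51/50 * r c)"
    if "b \<in> T" "c \<in> T" "b \<noteq> c" for b c
    using K T that unfolding controlled_def by blast
  have "finite near \<and> card near \<le> \<zeta>"
  proof (rule key)
    fix b c assume bc: "b \<in> near" "c \<in> near" "b \<noteq> c" "dist a c \<le> dist a b"
    then have bc': "b \<in> T" "c \<in> T" by (auto simp: near_def)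
    \<comment> \<open>Whichever alternative holds, \<open>dist b c\<close> exceeds one of
      \<open>r b\<close> and \<open>r c\<close>, both at least \<open>r a\<close>. Since
      \<open>dist a c > 50/51 * r a\<close>, the estimate reduces to
      \<open>8/5 - 2/3 * 50/51 < 1\<close>.\<close>
    have "r a < dist b c"
      using pair[OF bc' bc(3)] T[OF bc'(1)] T[OF bc'(2)] by linarith
    moreover have "dist a b < 8/5 * r a" using bc by (auto simp: near_def)
    ultimately show "dist a c / 3 \<le> dist b c - (dist a b - dist a c)"
      using lower(1)[OF bc'(2)] r[OF a] by linarith
  qed (auto simp: near_def)
  moreover have "finite far \<and> card far \<le> \<zeta>"
  proof (rule key)
    fix b c assume bc: "b \<in> far" "c \<in> far" "b \<noteq> c" "dist a c \<le> dist a b"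
    then have bc': "b \<in> T" "c \<in> T" by (auto simp: far_def)
    \<comment> \<open>In the second alternative \<open>r b - r c < r c / 50\<close> and
      \<open>r c < 51/50 * dist a c\<close>, which gives the loss
      \<open>1/50 * 51/50 = 51/2500\<close>. The final estimate then rests on
      \<open>(2/3 - 51/2500) * 8/5 > 1\<close>.\<close>
    have "r b - 51/2500 * dist a c \<le> dist b c"
      using pair[OF bc' bc(3)]
    proof (elim disjE)
      assume "r b < dist b c \<and> r c < 51/50 * r b"
      moreover have "0 \<le> dist a c" by simp
      ultimately show ?thesis by linarith
    next
      assume "r c < dist b c \<and> r b < 51/50 * r c"
      then show ?thesis using lower(2)[OF bc'(2)] by linarith
    qed
    moreover have "8/5 * r a \<le> dist a c" using bc by (auto simp: far_def)
    ultimately show "dist a c / 3 \<le> dist b c - (dist a b - dist a c)"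
      using upper[OF bc'(1)] r[OF a] by linarith
  qed (auto simp: far_def)
  moreover have "T = near \<union> far" by (auto simp: near_def far_def)
  ultimately show ?thesis using card_Un_le[of near far] by auto
qed

text \<open>Colours are assigned greedily in order of decreasing radius (ranking by
  \<open>- r\<close>). In this order every ball coloured earlier is at least as large, so the bound
  on larger neighbours counts all conflicts.\<close>

lemma disjoint_colouring:
  fixes r :: "'a::metric_space \<Rightarrow> real"
  assumes limited: "directionally_limited \<xi> \<eta> \<zeta> (UNIV :: 'a set)"
    and \<eta>: "0 < \<eta>" "\<eta> \<le> 1/3"
    and K: "controlled (51/50) r K"
    and r: "\<forall>x\<in>K. 0 < r x \<and> r x < \<xi> / 2"
    and S: "finite S" "S \<subseteq> K"
  shows "\<exists>f :: 'a \<Rightarrow> nat. (\<forall>x\<in>S. f x \<le> 2 * \<zeta>) \<and>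
    (\<forall>x\<in>S. \<forall>y\<in>S. x \<noteq> y \<longrightarrow> f x = f y \<longrightarrow> cball x (r x) \<inter> cball y (r y) = {})"
  using S
proof (induction S rule: finite_ranking_induct[where f = "\<lambda>x. - r x"])
  case empty
  then show ?case by simp
next
  case (insert a S)
  \<comment> \<open>\<open>a\<close> has the smallest radius, so at most \<open>2\<zeta>\<close> colours are forbidden for it.\<close>
  show ?case
  proof (cases "a \<in> S")
    case True
    then show ?thesis using insert by (simp add: insert_absorb)
  next
    case False
    obtain f :: "'a \<Rightarrow> nat" where f: "\<forall>x\<in>S. f x \<le> 2 * \<zeta>"
      "\<forall>x\<in>S. \<forall>y\<in>S. x \<noteq> y \<longrightarrow> f x = f y \<longrightarrow> cball x (r x) \<inter> cball y (r y) = {}"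
      using insert by auto
    define T where "T = {b\<in>S. cball a (r a) \<inter> cball b (r b) \<noteq> {}}"
    have T: "finite T \<and> card T \<le> 2 * \<zeta>"
      by (rule few_larger_neighbours[OF limited \<eta> K bspec[OF r], of a])
        (use insert False in \<open>auto simp: T_def\<close>)
    have "\<not> {..2 * \<zeta>} \<subseteq> f ` T"
    proof
      assume "{..2 * \<zeta>} \<subseteq> f ` T"
      then have "card {..2 * \<zeta>} \<le> card (f ` T)" using T by (intro card_mono) auto
      also have "\<dots> \<le> card T" using T by (intro card_image_le) auto
      finally show False using T by simp
    qed
    then obtain k where k: "k \<le> 2 * \<zeta>" "k \<notin> f ` T" by auto
    have new: "cball a (r a) \<inter> cball y (r y) = {}" if "y \<in> S" "f y = k" for y
      using that k(2) unfolding T_def by blast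
    show ?thesis
    proof (intro exI[of _ "f(a := k)"] conjI ballI impI)
      fix x assume "x \<in> insert a S"
      then show "(f(a := k)) x \<le> 2 * \<zeta>" using f(1) k(1) by auto
    next
      fix x y assume *: "x \<in> insert a S" "y \<in> insert a S" "x \<noteq> y" "(f(a := k)) x = (f(a := k)) y"
      show "cball x (r x) \<inter> cball y (r y) = {}"
      proof (cases "x = a \<or> y = a")
        case True
        then have "x = a \<and> y \<in> S \<and> f y = k \<or> y = a \<and> x \<in> S \<and> f x = k"
          using * by (auto split: if_splits)
        then show ?thesis using new[of x] new[of y] by (metis Int_commute)
      next
        case False
        then show ?thesis using * f(2) by simp
      qed
    qed
  qed
qed

section \<open>Closed balls as Method II covering sets\<close>

lemma diameter_cball_le:
  fixes x :: "'a::metric_space"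
  assumes "0 \<le> r"
  shows "diameter (cball x r) \<le> 2 * r"
proof -
  have "x \<in> cball x r" using assms by simp
  moreover have "dist y z \<le> 2 * r" if "y \<in> cball x r" "z \<in> cball x r" for y z
    using that dist_triangle3[of y z x] by auto
  ultimately show ?thesis
    unfolding diameter_def by (auto intro!: cSUP_least)
qed

lemma cball_in_fine_sets: "0 < r \<Longrightarrow> 2 * r \<le> \<delta> \<Longrightarrow> cball x r \<in> fine_sets closed_balls \<delta>"
  using diameter_cball_le[of r x] by (auto simp: fine_sets_def closed_balls_def)

lemma fine_sets_closed: "A \<in> fine_sets closed_balls \<delta> \<Longrightarrow> closed A"
  by (auto simp: fine_sets_def closed_balls_def)

text \<open>Reduces an upper bound for the infimum over sequences to finite subfamilies of a single
  countable cover, which is the form in which the covering estimates are available.\<close>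

lemma method_II_pre_le:
  assumes \<A>: "countable \<A>" "\<A> \<subseteq> fine_sets \<C> \<delta>" "E \<subseteq> \<Union>\<A>"
    and empty: "{} \<in> \<C>" "p {} = 0" "0 \<le> \<delta>"
    and c: "\<And>\<S>. finite \<S> \<Longrightarrow> \<S> \<subseteq> \<A> \<Longrightarrow> sum p \<S> \<le> c"
  shows "method_II_pre \<C> p \<delta> E \<le> c"
proof -
  define I where "I = to_nat_on \<A> ` \<A>"
  \<comment> \<open>Outside \<open>I\<close>, \<open>from_nat_into\<close> would return some member
    of the family again and count it repeatedly. Padding with \<open>{}\<close> costs
    nothing.\<close>
  define A where "A i = (if i \<in> I then from_nat_into \<A> i else {})" for i
  have from_to: "from_nat_into \<A> (to_nat_on \<A> B) = B" if "B \<in> \<A>" for B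
    using \<A>(1) that by simp
  have inI: "from_nat_into \<A> i \<in> \<A>" if "i \<in> I" for i
    using that from_to by (auto simp: I_def)
  have inj: "inj_on (from_nat_into \<A>) I"
    using from_to by (auto simp: I_def inj_on_def)
  have fine: "range A \<subseteq> fine_sets \<C> \<delta>"
    using inI \<A>(2) empty by (auto simp: A_def fine_sets_def)
  have "\<Union>\<A> \<subseteq> (\<Union>i. A i)"
  proof
    fix x assume "x \<in> \<Union>\<A>"
    then obtain B where B: "B \<in> \<A>" "x \<in> B" by blast
    then have "x \<in> A (to_nat_on \<A> B)" using from_to by (simp add: A_def I_def)
    then show "x \<in> (\<Union>i. A i)" by blast
  qed
  with \<A>(3) have cover: "E \<subseteq> (\<Union>i. A i)" by (rule order_trans)
  have "(\<Sum>i<n. p (A i)) \<le> c" for n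
  proof -
    have "(\<Sum>i<n. p (A i)) = (\<Sum>i\<in>{..<n} \<inter> I. p (from_nat_into \<A> i))"
      unfolding sum.inter_restrict[OF finite_lessThan] by (rule sum.cong) (simp_all add: A_def empty)
    also have "\<dots> = sum p (from_nat_into \<A> ` ({..<n} \<inter> I))"
      using inj by (subst sum.reindex) (auto intro: inj_on_subset)
    also have "\<dots> \<le> c" using inI by (intro c) auto
    finally show ?thesis .
  qed
  then have "(\<Sum>i. p (A i)) \<le> c"
    by (intro suminf_le_const) auto
  then show ?thesis
    unfolding method_II_pre_def using fine cover by (intro INF_lower2[of A]) auto
qed

section \<open>Exhaustion by disjoint balls\<close>

locale directionally_limited_measure =
  fixes \<mu> :: "'a::metric_space measure" and \<xi> \<eta> :: real and \<zeta> :: nat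
  assumes separable: "separable_space (euclidean :: 'a topology)"
    and \<xi>: "\<xi> > 0" and \<eta>: "0 < \<eta>" "\<eta> \<le> 1/3"
    and limited: "directionally_limited \<xi> \<eta> \<zeta> (UNIV :: 'a set)"
    and borel: "sets \<mu> = sets borel"
    and fin: "\<And>B. B \<in> sets borel \<Longrightarrow> bounded B \<Longrightarrow> emeasure \<mu> B < \<infinity>"
begin

lemma closed_sets [simp]: "closed A \<Longrightarrow> A \<in> sets \<mu>"
  and open_sets [simp]: "open A \<Longrightarrow> A \<in> sets \<mu>"
  by (simp_all add: borel)

lemma fine_controlled_cover:
  fixes E :: "'a set"
  assumes U: "open U" "E \<subseteq> U" and \<delta>: "0 < \<delta>"
  obtains K r where "K \<subseteq> E" "countable K" "controlled (51/50) r K" "E \<subseteq> (\<Union>x\<in>K. cball x (r x))"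
    "\<forall>x\<in>K. 0 < r x \<and> r x < \<xi> / 2" "\<forall>x\<in>K. cball x (r x) \<subseteq> U"
    "\<forall>x\<in>K. cball x (r x) \<in> fine_sets closed_balls \<delta>"
proof -
  have "\<exists>s>0. cball x s \<subseteq> U" if "x \<in> E" for x
    using U that open_contains_cball by blast
  then obtain s where s: "\<And>x. x \<in> E \<Longrightarrow> 0 < s x" "\<And>x. x \<in> E \<Longrightarrow> cball x (s x) \<subseteq> U" by metis
  \<comment> \<open>The bound \<open>\<xi> / 4\<close> makes the radii strictly smaller than
    \<open>\<xi> / 2\<close>, and \<open>\<delta> / 2\<close> bounds the diameters by
    \<open>\<delta>\<close>.\<close>
  define R where "R = min (\<xi> / 4) (\<delta> / 2)"
  define r where "r x = min (s x) R" for x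
  have R: "0 < R" "R < \<xi> / 2" "2 * R \<le> \<delta>" using \<xi> \<delta> by (auto simp: R_def)
  have r: "0 < r x" "r x \<le> R" if "x \<in> E" for x using that s R by (auto simp: r_def)
  have tau: "(1::real) < 51/50" by simp
  obtain K where K: "K \<subseteq> E" "controlled (51/50) r K" "E \<subseteq> (\<Union>x\<in>K. cball x (r x))"
    using controlled_cover[OF tau, of E r R] r by blast
  have rK: "0 < r x \<and> r x < \<xi> / 2" "2 * r x \<le> \<delta>" if "x \<in> K" for x
    using that K(1) r[of x] R by auto
  show thesis
  proof (rule that[OF K(1) _ K(2,3)])
    show "countable K"
      using controlled_countable[OF separable K(2)] rK by blast
    show "\<forall>x\<in>K. 0 < r x \<and> r x < \<xi> / 2" using rK by blast
    show "\<forall>x\<in>K. cball x (r x) \<subseteq> U"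
    proof
      fix x assume x: "x \<in> K"
      have "cball x (r x) \<subseteq> cball x (s x)" by (simp add: r_def subset_cball)
      then show "cball x (r x) \<subseteq> U" using s(2)[of x] x K(1) by blast
    qed
    show "\<forall>x\<in>K. cball x (r x) \<in> fine_sets closed_balls \<delta>"
      using rK by (auto intro: cball_in_fine_sets)
  qed
qed

text \<open>Each of the \<open>2 * \<zeta> + 1\<close> colour classes consists of disjoint balls
  inside \<open>V\<close>, so it contributes at most the measure of \<open>V\<close>.\<close>

lemma besicovitch_sum_le:
  assumes K: "controlled (51/50) r K" and r: "\<forall>x\<in>K. 0 < r x \<and> r x < \<xi> / 2"
    and S: "finite S" "S \<subseteq> K" and V: "V \<in> sets \<mu>" "\<forall>x\<in>S. cball x (r x) \<subseteq> V"
  shows "(\<Sum>x\<in>S. emeasure \<mu> (cball x (r x))) \<le> of_nat (2 * \<zeta> + 1) * emeasure \<mu> V"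
proof -
  obtain f :: "'a \<Rightarrow> nat" where f: "\<forall>x\<in>S. f x \<le> 2 * \<zeta>"
    "\<forall>x\<in>S. \<forall>y\<in>S. x \<noteq> y \<longrightarrow> f x = f y \<longrightarrow> cball x (r x) \<inter> cball y (r y) = {}"
    using disjoint_colouring[OF limited \<eta> K r S] by (elim exE conjE)
  have "(\<Sum>x\<in>S. emeasure \<mu> (cball x (r x)))
      = (\<Sum>k\<in>{..2 * \<zeta>}. \<Sum>x\<in>{x\<in>S. f x = k}. emeasure \<mu> (cball x (r x)))"
    using S f(1) by (subst sum.group) auto
  also have "\<dots> \<le> (\<Sum>k\<in>{..2 * \<zeta>}. emeasure \<mu> V)"
  proof (rule sum_mono)
    fix k
    have "(\<Sum>x\<in>{x\<in>S. f x = k}. emeasure \<mu> (cball x (r x)))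
        = emeasure \<mu> (\<Union>x\<in>{x\<in>S. f x = k}. cball x (r x))"
      using S(1) f(2) by (intro sum_emeasure) (auto simp: disjoint_family_on_def)
    also have "\<dots> \<le> emeasure \<mu> V" using V by (intro emeasure_mono) auto
    finally show "(\<Sum>x\<in>{x\<in>S. f x = k}. emeasure \<mu> (cball x (r x))) \<le> emeasure \<mu> V" .
  qed
  finally show ?thesis by simp
qed

text \<open>By pigeonhole one colour class of a finite subcover carries the fraction \<open>1 / (2\<zeta> + 1)\<close> of at least
  half of \<open>E\<close>.\<close>

lemma vitali_step:
  assumes E: "E \<in> sets \<mu>" "emeasure \<mu> E < \<infinity>" and U: "open U" "E \<subseteq> U" and \<delta>: "0 < \<delta>"
  obtains \<D> where "finite \<D>" "\<D> \<subseteq> fine_sets closed_balls \<delta>" "disjoint \<D>" "\<Union>\<D> \<subseteq> U"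
    "measure \<mu> (E - \<Union>\<D>) \<le> (1 - 1 / (2 * real (2 * \<zeta> + 1))) * measure \<mu> E"
\<comment> \<open>Null sets are split off because \<open>K \<noteq> {}\<close> and the strict bound
  by half the measure below use positivity.\<close>
proof (cases "measure \<mu> E = 0")
  case True
  then show thesis by (intro that[of "{}"]) auto
next
  case False
  define N where "N = real (2 * \<zeta> + 1)"
  have N: "0 < N" by (simp add: N_def)
  have pos: "0 < measure \<mu> E" using False by (simp add: zero_less_measure_iff)
  obtain K r where K: "K \<subseteq> E" "countable K" "controlled (51/50) r K" "E \<subseteq> (\<Union>x\<in>K. cball x (r x))"
    and r: "\<forall>x\<in>K. 0 < r x \<and> r x < \<xi> / 2" and sub: "\<forall>x\<in>K. cball x (r x) \<subseteq> U"
    and fine: "\<forall>x\<in>K. cball x (r x) \<in> fine_sets closed_balls \<delta>"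
    by (rule fine_controlled_cover[OF U \<delta>])
  have "K \<noteq> {}" using K(4) pos by auto
  \<comment> \<open>For finite \<open>K\<close> the enumeration repeats members. This is harmless,
    as only unions and the image set \<open>S\<close> are formed from it.\<close>
  define F where "F n = E \<inter> (\<Union>i<n. cball (from_nat_into K i) (r (from_nat_into K i)))" for n
  have F: "range F \<subseteq> sets \<mu>" using E(1) by (auto simp: F_def intro!: sets.Int sets.finite_UN)
  have "(\<Union>n. F n) = E"
  proof (intro equalityI subsetI)
    fix y assume "y \<in> E"
    then obtain x where "x \<in> K" "y \<in> cball x (r x)" using K(4) by blast
    then have "y \<in> F (Suc (to_nat_on K x))"
      using \<open>y \<in> E\<close> K(2) by (force simp: F_def)
    then show "y \<in> (\<Union>n. F n)" by blast
  qed (auto simp: F_def)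
  moreover have "(\<lambda>n. measure \<mu> (F n)) \<longlonglongrightarrow> measure \<mu> (\<Union>n. F n)"
    using F E(2) \<open>(\<Union>n. F n) = E\<close>
    by (intro Lim_measure_incseq incseq_SucI) (auto simp: F_def less_Suc_eq)
  ultimately have "(\<lambda>n. measure \<mu> (F n)) \<longlonglongrightarrow> measure \<mu> E" by simp
  then have "\<forall>\<^sub>F n in sequentially. measure \<mu> E / 2 < measure \<mu> (F n)"
    by (rule order_tendstoD) (use pos in simp)
  then obtain n where n: "measure \<mu> E / 2 < measure \<mu> (F n)"
    by (auto simp: eventually_sequentially)
  define S where "S = from_nat_into K ` {..<n}"
  have S: "finite S" "S \<subseteq> K"
    using from_nat_into[OF \<open>K \<noteq> {}\<close>] by (auto simp: S_def)
  obtain f :: "'a \<Rightarrow> nat" where f: "\<forall>x\<in>S. f x \<le> 2 * \<zeta>"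
    "\<forall>x\<in>S. \<forall>y\<in>S. x \<noteq> y \<longrightarrow> f x = f y \<longrightarrow> cball x (r x) \<inter> cball y (r y) = {}"
    using disjoint_colouring[OF limited \<eta> K(3) r S] by (elim exE conjE)
  define G where "G k = E \<inter> (\<Union>x\<in>{x\<in>S. f x = k}. cball x (r x))" for k
  have G: "G k \<in> sets \<mu>" for k using E(1) S(1) by (auto simp: G_def intro!: sets.Int sets.finite_UN)
  have G_fin: "emeasure \<mu> (G k) < \<infinity>" for k
    using emeasure_mono[of "G k" E \<mu>] E by (auto simp: G_def intro: le_less_trans)
  have "F n = (\<Union>k\<in>{..2 * \<zeta>}. G k)" using f(1) by (auto simp: F_def G_def S_def)
  then have "measure \<mu> (F n) \<le> (\<Sum>k\<in>{..2 * \<zeta>}. measure \<mu> (G k))"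
    using G G_fin by (auto intro!: measure_UNION_le)
  have "\<exists>k. measure \<mu> E / (2 * N) \<le> measure \<mu> (G k)"
  proof (rule ccontr)
    assume "\<not> ?thesis"
    then have "(\<Sum>k\<in>{..2 * \<zeta>}. measure \<mu> (G k)) \<le> (\<Sum>k\<in>{..2 * \<zeta>}. measure \<mu> E / (2 * N))"
      by (intro sum_mono) (auto simp: not_le intro: less_imp_le)
    also have "\<dots> = N * (measure \<mu> E / (2 * N))" by (simp add: N_def add.commute)
    also have "\<dots> = measure \<mu> E / 2" using N by simp
    finally show False using n \<open>measure \<mu> (F n) \<le> _\<close> by linarith
  qed
  then obtain k where k: "measure \<mu> E / (2 * N) \<le> measure \<mu> (G k)" by blast
  define \<D> where "\<D> = (\<lambda>x. cball x (r x)) ` {x\<in>S. f x = k}"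
  have G_eq: "G k = E \<inter> \<Union>\<D>" by (simp add: G_def \<D>_def)
  show thesis
  proof
    show "finite \<D>" using S by (simp add: \<D>_def)
    show "\<D> \<subseteq> fine_sets closed_balls \<delta>" using S fine by (auto simp: \<D>_def)
    show "disjoint \<D>"
    proof (rule disjointI)
      fix A B assume AB: "A \<in> \<D>" "B \<in> \<D>" "A \<noteq> B"
      obtain x where x: "A = cball x (r x)" "x \<in> S" "f x = k" using AB(1) unfolding \<D>_def by blast
      obtain y where y: "B = cball y (r y)" "y \<in> S" "f y = k" using AB(2) unfolding \<D>_def by blast
      have "x \<noteq> y" using AB(3) x(1) y(1) by blast
      with f(2) x y show "A \<inter> B = {}" by simp
    qed
    show "\<Union>\<D> \<subseteq> U" using sub S by (force simp: \<D>_def)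
    have "measure \<mu> (E - \<Union>\<D>) = measure \<mu> (E - G k)"
      by (rule arg_cong[of _ _ "measure \<mu>"]) (auto simp: G_eq)
    also have "\<dots> = measure \<mu> E - measure \<mu> (G k)"
      using E G by (intro measure_Diff) (auto simp: G_def)
    also have "\<dots> \<le> measure \<mu> E - measure \<mu> E / (2 * N)" using k by simp
    also have "\<dots> = (1 - 1 / (2 * N)) * measure \<mu> E" by (simp add: algebra_simps)
    finally show "measure \<mu> (E - \<Union>\<D>) \<le> (1 - 1 / (2 * real (2 * \<zeta> + 1))) * measure \<mu> E"
      by (simp only: N_def)
  qed
qed

text \<open>A finite union of closed balls is closed, so the single step applies to the remainder
  inside the open set \<open>U - \<Union>\<D>\<close>. The new balls are then automatically disjoint
  from the old ones, and the factors multiply.\<close>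

lemma vitali_iterate:
  assumes E: "E \<in> sets \<mu>" "emeasure \<mu> E < \<infinity>" and U: "open U" "E \<subseteq> U" and \<delta>: "0 < \<delta>"
  shows "\<exists>\<D>. finite \<D> \<and> \<D> \<subseteq> fine_sets closed_balls \<delta> \<and> disjoint \<D> \<and> \<Union>\<D> \<subseteq> U \<and>
    measure \<mu> (E - \<Union>\<D>) \<le> (1 - 1 / (2 * real (2 * \<zeta> + 1))) ^ n * measure \<mu> E"
proof (induction n)
  case 0
  show ?case by (intro exI[of _ "{}"]) auto
next
  case (Suc n)
  define q where "q = 1 - 1 / (2 * real (2 * \<zeta> + 1))"
  have q: "0 \<le> q" by (simp add: q_def field_simps)
  from Suc obtain \<D> where \<D>: "finite \<D>" "\<D> \<subseteq> fine_sets closed_balls \<delta>" "disjoint \<D>" "\<Union>\<D> \<subseteq> U"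
    "measure \<mu> (E - \<Union>\<D>) \<le> q ^ n * measure \<mu> E" unfolding q_def by (elim exE conjE)
  have closed: "closed (\<Union>\<D>)" using \<D>(1,2) fine_sets_closed by (intro closed_Union) blast+
  have E': "E - \<Union>\<D> \<in> sets \<mu>" using E(1) closed by auto
  have E'_fin: "emeasure \<mu> (E - \<Union>\<D>) < \<infinity>"
    using emeasure_mono[of "E - \<Union>\<D>" E \<mu>] E by (auto intro: le_less_trans)
  have U': "open (U - \<Union>\<D>)" "E - \<Union>\<D> \<subseteq> U - \<Union>\<D>" using U closed by auto
  obtain \<D>' where \<D>': "finite \<D>'" "\<D>' \<subseteq> fine_sets closed_balls \<delta>" "disjoint \<D>'" "\<Union>\<D>' \<subseteq> U - \<Union>\<D>"
    "measure \<mu> (E - \<Union>\<D> - \<Union>\<D>') \<le> q * measure \<mu> (E - \<Union>\<D>)"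
    unfolding q_def by (rule vitali_step[OF E' E'_fin U' \<delta>])
  have "disjoint (\<D> \<union> \<D>')"
    using \<D>(3) \<D>'(3,4) by (intro disjoint_union) auto
  moreover have "measure \<mu> (E - \<Union>(\<D> \<union> \<D>')) \<le> q ^ Suc n * measure \<mu> E"
  proof -
    have "E - \<Union>(\<D> \<union> \<D>') = E - \<Union>\<D> - \<Union>\<D>'" by blast
    then have "measure \<mu> (E - \<Union>(\<D> \<union> \<D>')) \<le> q * measure \<mu> (E - \<Union>\<D>)" using \<D>'(5) by simp
    also have "\<dots> \<le> q * (q ^ n * measure \<mu> E)" using \<D>(5) q by (intro mult_left_mono)
    finally show ?thesis by (simp add: mult.assoc)
  qed
  ultimately show ?case
    unfolding q_def[symmetric] using \<D>(1,2,4) \<D>'(1,2,4) by (intro exI[of _ "\<D> \<union> \<D>'"]) auto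
qed

text \<open>The factor lost in each round is below 1, so finitely many rounds leave at most
  \<open>e\<close>.\<close>

lemma finite_vitali:
  assumes E: "E \<in> sets \<mu>" "emeasure \<mu> E < \<infinity>" and U: "open U" "E \<subseteq> U" and \<delta>: "0 < \<delta>"
    and e: "0 < (e::real)"
  obtains \<D> where "finite \<D>" "\<D> \<subseteq> fine_sets closed_balls \<delta>" "disjoint \<D>" "\<Union>\<D> \<subseteq> U"
    "emeasure \<mu> (E - \<Union>\<D>) \<le> ennreal e"
proof -
  define q where "q = 1 - 1 / (2 * real (2 * \<zeta> + 1))"
  have "0 \<le> q" "q < 1" by (simp_all add: q_def field_simps)
  then have "(\<lambda>n. q ^ n * measure \<mu> E) \<longlonglongrightarrow> 0 * measure \<mu> E"
    by (intro tendsto_mult_right LIMSEQ_power_zero) simp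
  then have "\<forall>\<^sub>F n in sequentially. q ^ n * measure \<mu> E < e"
    using e by (auto intro: order_tendstoD)
  then obtain n where n: "q ^ n * measure \<mu> E < e"
    by (auto simp: eventually_sequentially)
  obtain \<D> where \<D>: "finite \<D>" "\<D> \<subseteq> fine_sets closed_balls \<delta>" "disjoint \<D>" "\<Union>\<D> \<subseteq> U"
    "measure \<mu> (E - \<Union>\<D>) \<le> q ^ n * measure \<mu> E"
    using vitali_iterate[OF E U \<delta>, of n] unfolding q_def by (elim exE conjE)
  have "emeasure \<mu> (E - \<Union>\<D>) \<le> emeasure \<mu> E"
    using E by (intro emeasure_mono) auto
  then have "emeasure \<mu> (E - \<Union>\<D>) \<noteq> \<infinity>" using E(2) by auto
  then have "emeasure \<mu> (E - \<Union>\<D>) = ennreal (measure \<mu> (E - \<Union>\<D>))"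
    by (intro emeasure_eq_ennreal_measure) simp
  also have "\<dots> \<le> ennreal e" using \<D>(5) n by (intro ennreal_leI) linarith
  finally show thesis using that \<D> by blast
qed

section \<open>Identification of the Method II measure\<close>

text \<open>Equality already holds at every scale \<open>\<delta>\<close>, so the limit in Method II
  is that of a constant.\<close>

lemma method_II_pre_eq:
  assumes E: "E \<in> sets borel" and \<delta>: "0 < \<delta>"
  shows "method_II_pre closed_balls (emeasure \<mu>) \<delta> E = emeasure \<mu> E"
proof (rule antisym)
  show "emeasure \<mu> E \<le> method_II_pre closed_balls (emeasure \<mu>) \<delta> E"
    unfolding method_II_pre_def
  proof (rule INF_greatest, clarify)
    fix A :: "nat \<Rightarrow> 'a set" assume A: "range A \<subseteq> fine_sets closed_balls \<delta>" "E \<subseteq> (\<Union>i. A i)"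
    have meas: "A i \<in> sets \<mu>" for i
      using A(1) by (intro closed_sets fine_sets_closed) auto
    have "emeasure \<mu> E \<le> emeasure \<mu> (\<Union>i. A i)" using A(2) meas by (intro emeasure_mono) auto
    also have "\<dots> \<le> (\<Sum>i. emeasure \<mu> (A i))" using meas by (intro emeasure_subadditive_countably) auto
    finally show "emeasure \<mu> E \<le> (\<Sum>i. emeasure \<mu> (A i))" .
  qed
  show "method_II_pre closed_balls (emeasure \<mu>) \<delta> E \<le> emeasure \<mu> E"
  \<comment> \<open>This rule also supplies finiteness of the measure of \<open>E\<close>, which the
    exhaustion requires.\<close>
  proof (rule ennreal_le_epsilon)
    fix e :: real assume E_fin: "emeasure \<mu> E < top" and e: "0 < e"
    define N where "N = 2 * \<zeta> + 1"
    \<comment> \<open>Half of \<open>e\<close> is spent on \<open>U - E\<close>. The set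
      \<open>V\<close> will have measure at most \<open>2 * d\<close>, and
      \<open>N * (2 * d) = e / 2\<close> is the other half.\<close>
    define d where "d = e / (4 * real N)"
    have d: "0 < d" using e by (simp add: d_def N_def)
    have E_sets: "E \<in> sets \<mu>" using E by (simp add: borel)
    have "0 < e / 2" using e by simp
    from outer_regular_of_finite_on_bounded[OF borel fin E this]
    obtain U where U: "open U" "E \<subseteq> U" "emeasure \<mu> (U - E) \<le> ennreal (e / 2)" by blast
    obtain \<D> where \<D>: "finite \<D>" "\<D> \<subseteq> fine_sets closed_balls \<delta>" "disjoint \<D>" "\<Union>\<D> \<subseteq> U"
      "emeasure \<mu> (E - \<Union>\<D>) \<le> ennreal d"
      using finite_vitali[OF E_sets _ U(1,2) \<delta> d] E_fin by auto
    have closed: "closed A" if "A \<in> \<D>" for A using \<D>(2) that fine_sets_closed by blast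
    define E' where "E' = E - \<Union>\<D>"
    have E': "E' \<in> sets borel" unfolding E'_def using \<D>(1) closed
      by (intro sets.Diff E borel_closed closed_Union) auto
    from outer_regular_of_finite_on_bounded[OF borel fin E' d]
    obtain V where V: "open V" "E' \<subseteq> V" "emeasure \<mu> (V - E') \<le> ennreal d" by blast
    have V_le: "of_nat N * emeasure \<mu> V \<le> ennreal (e / 2)"
    proof -
      have "emeasure \<mu> V = emeasure \<mu> (E' \<union> (V - E'))" using V(2) by (simp add: Un_absorb1)
      also have "\<dots> \<le> emeasure \<mu> E' + emeasure \<mu> (V - E')"
        using E' V(1) by (intro emeasure_subadditive) (auto simp: borel)
      also have "\<dots> \<le> ennreal d + ennreal d" using \<D>(5) V(3) unfolding E'_def by (rule add_mono)
      finally have "of_nat N * emeasure \<mu> V \<le> of_nat N * (ennreal d + ennreal d)"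
        by (rule mult_left_mono) simp
      also have "\<dots> = ennreal (e / 2)"
        using d by (simp add: ennreal_of_nat_eq_real_of_nat ennreal_plus[symmetric] ennreal_mult[symmetric] del: ennreal_plus)
          (simp add: d_def N_def field_simps)
      finally show ?thesis .
    qed
    have U_le: "emeasure \<mu> U \<le> emeasure \<mu> E + ennreal (e / 2)"
    proof -
      have "emeasure \<mu> U = emeasure \<mu> (E \<union> (U - E))" using U(2) by (simp add: Un_absorb1)
      also have "\<dots> \<le> emeasure \<mu> E + emeasure \<mu> (U - E)"
        using E_sets U(1) by (intro emeasure_subadditive) auto
      also have "\<dots> \<le> emeasure \<mu> E + ennreal (e / 2)" using U(3) by (intro add_left_mono)
      finally show ?thesis .
    qed
    obtain K r where K: "countable K" "controlled (51/50) r K" "E' \<subseteq> (\<Union>x\<in>K. cball x (r x))"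
      and r: "\<forall>x\<in>K. 0 < r x \<and> r x < \<xi> / 2" and sub: "\<forall>x\<in>K. cball x (r x) \<subseteq> V"
      and fine: "\<forall>x\<in>K. cball x (r x) \<in> fine_sets closed_balls \<delta>"
      by (rule fine_controlled_cover[OF V(1,2) \<delta>])
    let ?B = "\<lambda>x. cball x (r x)"
    show "method_II_pre closed_balls (emeasure \<mu>) \<delta> E \<le> emeasure \<mu> E + ennreal e"
    proof (rule method_II_pre_le)
      show "countable (\<D> \<union> ?B ` K)" using K(1) \<D>(1) by (auto intro: countable_finite)
      show "\<D> \<union> ?B ` K \<subseteq> fine_sets closed_balls \<delta>" using \<D>(2) fine by auto
      show "E \<subseteq> \<Union>(\<D> \<union> ?B ` K)" using K(3) by (auto simp: E'_def)
      show "{} \<in> closed_balls" by (simp add: closed_balls_def)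
      show "emeasure \<mu> {} = 0" "0 \<le> \<delta>" using \<delta> by simp_all
      fix \<S> assume \<S>: "finite \<S>" "\<S> \<subseteq> \<D> \<union> ?B ` K"
      \<comment> \<open>The balls outside \<open>\<D>\<close> are pulled back to a finite set of
        centres, to which the colouring bound applies.\<close>
      have "\<S> - \<D> \<subseteq> ?B ` K" "finite (\<S> - \<D>)" using \<S> by auto
      then obtain S where S: "S \<subseteq> K" "finite S" "\<S> - \<D> = ?B ` S"
        by (meson finite_subset_image)
      have "sum (emeasure \<mu>) \<S> \<le> sum (emeasure \<mu>) (\<D> \<union> ?B ` S)"
        using \<S>(1) \<D>(1) S by (intro sum_mono2) auto
      also have "\<dots> \<le> sum (emeasure \<mu>) (\<D> \<union> ?B ` S) + sum (emeasure \<mu>) (\<D> \<inter> ?B ` S)"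
        by simp
      also have "\<dots> = sum (emeasure \<mu>) \<D> + sum (emeasure \<mu>) (?B ` S)"
        using \<D>(1) S(2) by (intro sum.union_inter) auto
      also have "sum (emeasure \<mu>) \<D> \<le> emeasure \<mu> U"
      proof -
        have "sum (emeasure \<mu>) \<D> = emeasure \<mu> (\<Union>A\<in>\<D>. A)"
          using \<D>(1,3) closed by (intro sum_emeasure) (auto simp: disjoint_family_on_def disjoint_def)
        also have "\<dots> \<le> emeasure \<mu> U" using \<D>(4) U(1) by (intro emeasure_mono) auto
        finally show ?thesis .
      qed
      also have "sum (emeasure \<mu>) (?B ` S) \<le> (\<Sum>x\<in>S. emeasure \<mu> (?B x))"
        using sum_image_le[of S "emeasure \<mu>" ?B] S(2) by (simp add: o_def)
      also have "(\<Sum>x\<in>S. emeasure \<mu> (?B x)) \<le> of_nat N * emeasure \<mu> V"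
        unfolding N_def using S sub V(1) by (intro besicovitch_sum_le[OF K(2) r]) auto
      also note V_le
      also note U_le
      also have "emeasure \<mu> E + ennreal (e / 2) + ennreal (e / 2) = emeasure \<mu> E + ennreal e"
        using e by (simp add: add.assoc ennreal_plus[symmetric] del: ennreal_plus)
      finally show "sum (emeasure \<mu>) \<S> \<le> emeasure \<mu> E + ennreal e"
        by (simp add: add_mono)
    qed
  qed
qed

end

theorem proposition2p11:
  fixes \<mu> :: "'a::metric_space measure"
    and \<xi> \<eta> :: real and \<zeta> :: nat
  assumes separable: "separable_space (euclidean :: 'a topology)"
    and parameters: "\<xi> > 0" "0 < \<eta>" "\<eta> \<le> 1/3" "\<zeta> \<ge> 1"
    and limited: "directionally_limited \<xi> \<eta> \<zeta> (UNIV :: 'a set)"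
    and borel: "sets \<mu> = sets borel"
    and finite_on_bounded:
      "\<And>B. B \<in> sets borel \<Longrightarrow> bounded B \<Longrightarrow> emeasure \<mu> B < \<infinity>"
  shows "method_II_measure closed_balls (emeasure \<mu>) = \<mu>"
proof -
  interpret directionally_limited_measure \<mu> \<xi> \<eta> \<zeta>
    by standard fact+
  have method_II: "method_II closed_balls (emeasure \<mu>) E = emeasure \<mu> E" if E: "E \<in> sets borel" for E
    unfolding method_II_def
  proof (rule tendsto_Lim)
    have "\<forall>\<^sub>F \<delta> in at_right 0. emeasure \<mu> E = method_II_pre closed_balls (emeasure \<mu>) \<delta> E"
      using method_II_pre_eq[OF E] by (auto simp: eventually_at_filter)
    then show "((\<lambda>\<delta>. method_II_pre closed_balls (emeasure \<mu>) \<delta> E) \<longlongrightarrow> emeasure \<mu> E) (at_right 0)"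
      by (rule Lim_transform_eventually[OF tendsto_const])
  qed simp
  have "space \<mu> = UNIV" using sets_eq_imp_space_eq[OF borel] by simp
  \<comment> \<open>Agreement of the two set functions on Borel sets suffices, so countable
    additivity is inherited from \<open>\<mu>\<close>.\<close>
  have "method_II_measure closed_balls (emeasure \<mu>) = measure_of UNIV (sets borel) (emeasure \<mu>)"
    unfolding method_II_measure_def
  proof (rule measure_of_eq)
    fix E :: "'a set" assume "E \<in> sigma_sets UNIV (sets borel)"
    then have "E \<in> sets borel" using sets.sigma_sets_eq[of "borel :: 'a measure"] by simp
    then show "method_II closed_balls (emeasure \<mu>) E = emeasure \<mu> E" by (rule method_II)
  qed simp
  also have "\<dots> = \<mu>"
    using measure_of_of_measure[of \<mu>] by (simp add: borel \<open>space \<mu> = UNIV\<close>)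
  finally show ?thesis .
qed

end
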